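(* For every consistent formula $\varphi\in\mathcal{L}$ (i.e. $\neg\varphi$ is not derivable, $\not\vdash\neg\varphi$), there exist a WTS $\mathcal{M}=(S,\rightarrow,\ell)$ with $S$ finite and a state $s\in S$ such that $\mathcal{M},s\models\varphi$.
   Context: Fix a countable set $\mathcal{AP}$ of atomic propositions. A weighted transition system (WTS) is a triple $\mathcal{M}=(S,\rightarrow,\ell)$ where $S$ is a non-empty set of states, $\rightarrow\subseteq S\times\mathbb{R}_{\ge 0}\times S$ is a transition relation (write $s\xrightarrow{r}t$), and $\ell:S\to 2^{\mathcal{AP}}$ is a labeling. For $s\in S$, $T\subseteq S$ let $\theta(s)(T)=\{r\mid \exists t\in T,\ s\xrightarrow{r}t\}$; $\theta^-(s)(T)=-\infty$ if $\theta(s)(T)=\emptyset$, else $\inf\theta(s)(T)$; $\theta^+(s)(T)=\infty$ if $\theta(s)(T)=\emptyset$, else $\sup\theta(s)(T)$. Formulae of $\mathcal{L}$: $\varphi::= p\mid\neg\varphi\mid\varphi\wedge\varphi\mid L_r\varphi\mid M_r\varphi$ with $p\in\mathcal{AP}$, $r\in\mathbb{Q}_{\ge0}$; $\bot,\vee,\to,\leftrightarrow$ defined as usual. Semantics: $\mathcal{M},s\models p$ iff $p\in\ell(s)$; Boolean cases as usual; $\mathcal{M},s\models L_r\varphi$ iff $\theta^-(s)([\![\varphi]\!])\ge r$; $\mathcal{M},s\models M_r\varphi$ iff $\theta^+(s)([\![\varphi]\!])\le r$, where $[\![\varphi]\!]$ is the set of states satisfying $\varphi$. Axiomatic system: $\vdash\varphi$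 means $\varphi$ belongs to the smallest set of formulae containing all instances of propositional tautologies and of the axioms below, closed under modus ponens and the rules below (all $r,q\in\mathbb{Q}_{\ge0}$): (A1) $\neg L_0\bot$; (A2) $L_{r+q}\varphi\to L_r\varphi$ if $q>0$; (A2$'$) $M_r\varphi\to M_{r+q}\varphi$ if $q>0$; (A3) $L_r\varphi\wedge L_q\psi\to L_{\min\{r,q\}}(\varphi\vee\psi)$; (A3$'$) $M_r\varphi\wedge M_q\psi\to M_{\max\{r,q\}}(\varphi\vee\psi)$; (A4) $L_r(\varphi\vee\psi)\to L_r\varphi\vee L_r\psi$; (A5) $\neg L_0\psi\to(L_r\varphi\to L_r(\varphi\vee\psi))$; (A5$'$) $\neg L_0\psi\to(M_r\varphi\to M_r(\varphi\vee\psi))$; (A6) $L_{r+q}\varphi\to\neg M_r\varphi$ if $q>0$; (A7) $M_r\varphi\to L_0\varphi$; (R1) from $\vdash\varphi\to\psi$ infer $\vdash(L_r\psi\wedge L_0\varphi)\to L_r\varphi$; (R1$'$) from $\vdash\varphi\to\psi$ infer $\vdash(M_r\psi\wedge L_0\varphi)\to M_r\varphi$; (R2) from $\vdash\varphi\to\psi$ infer $\vdash L_0\varphi\to L_0\psi$. A formula $\varphi$ is consistent if $\bot$ cannot be derived from it, i.e. $\not\vdash\neg\varphi$. *)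

theory Defs
  imports Complex_Main "HOL-Library.Extended_Real" "HOL-Library.Countable"
begin

typedef nnrat = "{r :: rat. 0 \<le> r}"
  morphisms rat_of_nnrat Abs_nnrat
  by auto

setup_lifting type_definition_nnrat

instantiation nnrat :: "{zero, plus, linorder}"
begin

lift_definition zero_nnrat :: nnrat is "0" by simp
lift_definition plus_nnrat :: "nnrat \<Rightarrow> nnrat \<Rightarrow> nnrat" is "(+)" by simp
lift_definition less_eq_nnrat :: "nnrat \<Rightarrow> nnrat \<Rightarrow> bool" is "(\<le>)" .
lift_definition less_nnrat :: "nnrat \<Rightarrow> nnrat \<Rightarrow> bool" is "(<)" .

instance
  by standard (transfer; force)+

end

definition ereal_of_nnrat :: "nnrat \<Rightarrow> ereal" where
  "ereal_of_nnrat r = ereal (of_rat (rat_of_nnrat r))"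

record ('s, 'p) wts =
  states :: "'s set"
  edges :: "('s \<times> real \<times> 's) set"
  label :: "'s \<Rightarrow> 'p set"

definition is_wts :: "('s, 'p) wts \<Rightarrow> bool" where
  "is_wts W \<longleftrightarrow> states W \<noteq> {} \<and> edges W \<subseteq> states W \<times> {0..} \<times> states W"

definition theta :: "('s, 'p) wts \<Rightarrow> 's \<Rightarrow> 's set \<Rightarrow> real set" where
  "theta W s T = {r. \<exists>t\<in>T. (s, r, t) \<in> edges W}"

text \<open>On the empty set these conventions are the opposite of those of \<^const>\<open>Inf\<close> and
  \<^const>\<open>Sup\<close> on \<^typ>\<open>ereal\<close>.\<close>

definition theta_minus :: "('s, 'p) wts \<Rightarrow> 's \<Rightarrow> 's set \<Rightarrow> ereal" where
  "theta_minus W s T = (if theta W s T = {} then -\<infinity> else Inf (ereal ` theta W s T))"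

definition theta_plus :: "('s, 'p) wts \<Rightarrow> 's \<Rightarrow> 's set \<Rightarrow> ereal" where
  "theta_plus W s T = (if theta W s T = {} then \<infinity> else Sup (ereal ` theta W s T))"

datatype 'p fm =
    Atom 'p
  | Neg "'p fm"
  | And "'p fm" "'p fm"
  | L nnrat "'p fm"
  | M nnrat "'p fm"

definition Or :: "'p fm \<Rightarrow> 'p fm \<Rightarrow> 'p fm" where
  "Or \<phi> \<psi> = Neg (And (Neg \<phi>) (Neg \<psi>))"

definition Imp :: "'p fm \<Rightarrow> 'p fm \<Rightarrow> 'p fm" where
  "Imp \<phi> \<psi> = Neg (And \<phi> (Neg \<psi>))"

text \<open>Falsum is \<open>p \<and> \<not> p\<close> for a fixed but arbitrary atom \<open>p\<close>. By rule R2 below, the choice of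
  \<open>p\<close> does not affect derivability.\<close>

definition Bot :: "'p fm" where
  "Bot = (let p = (SOME p. True) in And (Atom p) (Neg (Atom p)))"

primrec sat :: "('s, 'p) wts \<Rightarrow> 's \<Rightarrow> 'p fm \<Rightarrow> bool" where
  "sat W s (Atom p) \<longleftrightarrow> p \<in> label W s"
| "sat W s (Neg \<phi>) \<longleftrightarrow> \<not> sat W s \<phi>"
| "sat W s (And \<phi> \<psi>) \<longleftrightarrow> sat W s \<phi> \<and> sat W s \<psi>"
| "sat W s (L r \<phi>) \<longleftrightarrow> theta_minus W s {t \<in> states W. sat W t \<phi>} \<ge> ereal_of_nnrat r"
| "sat W s (M r \<phi>) \<longleftrightarrow> theta_plus W s {t \<in> states W. sat W t \<phi>} \<le> ereal_of_nnrat r"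

text \<open>Propositional schemes: a tautology instance is \<open>subst \<sigma> A\<close> for a two-valued tautology \<open>A\<close> and
  a substitution \<open>\<sigma>\<close> of arbitrary formulae for its propositional variables.\<close>

datatype pform = PVar nat | PNeg pform | PAnd pform pform

primrec peval :: "(nat \<Rightarrow> bool) \<Rightarrow> pform \<Rightarrow> bool" where
  "peval v (PVar n) \<longleftrightarrow> v n"
| "peval v (PNeg A) \<longleftrightarrow> \<not> peval v A"
| "peval v (PAnd A B) \<longleftrightarrow> peval v A \<and> peval v B"

primrec subst :: "(nat \<Rightarrow> 'p fm) \<Rightarrow> pform \<Rightarrow> 'p fm" where
  "subst \<sigma> (PVar n) = \<sigma> n"
| "subst \<sigma> (PNeg A) = Neg (subst \<sigma> A)"
| "subst \<sigma> (PAnd A B) = And (subst \<sigma> A) (subst \<sigma> B)"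

definition tautology :: "pform \<Rightarrow> bool" where
  "tautology A \<longleftrightarrow> (\<forall>v. peval v A)"

inductive derivable :: "'p fm \<Rightarrow> bool" (\<open>\<turnstile> _\<close> [50] 50) where
  Taut: "tautology A \<Longrightarrow> \<turnstile> subst \<sigma> A"
| A1: "\<turnstile> Neg (L 0 Bot)"
| A2: "q > 0 \<Longrightarrow> \<turnstile> Imp (L (r + q) \<phi>) (L r \<phi>)"
| A2': "q > 0 \<Longrightarrow> \<turnstile> Imp (M r \<phi>) (M (r + q) \<phi>)"
| A3: "\<turnstile> Imp (And (L r \<phi>) (L q \<psi>)) (L (min r q) (Or \<phi> \<psi>))"
| A3': "\<turnstile> Imp (And (M r \<phi>) (M q \<psi>)) (M (max r q) (Or \<phi> \<psi>))"
| A4: "\<turnstile> Imp (L r (Or \<phi> \<psi>)) (Or (L r \<phi>) (L r \<psi>))"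
| A5: "\<turnstile> Imp (Neg (L 0 \<psi>)) (Imp (L r \<phi>) (L r (Or \<phi> \<psi>)))"
| A5': "\<turnstile> Imp (Neg (L 0 \<psi>)) (Imp (M r \<phi>) (M r (Or \<phi> \<psi>)))"
| A6: "q > 0 \<Longrightarrow> \<turnstile> Imp (L (r + q) \<phi>) (Neg (M r \<phi>))"
| A7: "\<turnstile> Imp (M r \<phi>) (L 0 \<phi>)"
| MP: "\<turnstile> \<phi> \<Longrightarrow> \<turnstile> Imp \<phi> \<psi> \<Longrightarrow> \<turnstile> \<psi>"
| R1: "\<turnstile> Imp \<phi> \<psi> \<Longrightarrow> \<turnstile> Imp (And (L r \<psi>) (L 0 \<phi>)) (L r \<phi>)"
| R1': "\<turnstile> Imp \<phi> \<psi> \<Longrightarrow> \<turnstile> Imp (And (M r \<psi>) (L 0 \<phi>)) (M r \<phi>)"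
| R2: "\<turnstile> Imp \<phi> \<psi> \<Longrightarrow> \<turnstile> Imp (L 0 \<phi>) (L 0 \<psi>)"

definition consistent :: "'p fm \<Rightarrow> bool" where
  "consistent \<phi> \<longleftrightarrow> \<not> (\<turnstile> Neg \<phi>)"

end

(* A valuation that respects negation, conjunction and derivability plays the role of a maximal
   consistent set. Only finitely many subformulae and rational bounds occur in the given formula, so
   finitely many worlds represent all behaviours on the subformulae, and each of them has a
   characteristic formula. A transition from w to the j-th world exists iff w makes L_0 of its
   characteristic formula true, and then carries all weights that obey the occurring bounds which w
   asserts for that formula. A6 makes this interval non-empty, and the axioms and rules A3, A4, A5,
   R1, R2 decompose L_r and M_r over the disjunction of characteristic formulae to which a
   subformula is equivalent. *)

theory Submission imports Defs begin

section \<open>Worlds\<close>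

text \<open>Countability of rational bounds and of atoms makes the formulae countable;
  \<open>linden\<close> relies on the resulting enumeration \<open>from_nat\<close>.\<close>

instance nnrat :: countable
  by (rule countable_classI[of "to_nat \<circ> rat_of_nnrat"]) (simp add: rat_of_nnrat_inject)

instance fm :: (countable) countable
  by countable_datatype

definition world :: "('p fm \<Rightarrow> bool) \<Rightarrow> bool" where
  "world v \<longleftrightarrow> (\<forall>\<phi>. \<turnstile> \<phi> \<longrightarrow> v \<phi>) \<and> (\<forall>\<phi>. v (Neg \<phi>) \<longleftrightarrow> \<not> v \<phi>) \<and>
     (\<forall>\<phi> \<psi>. v (And \<phi> \<psi>) \<longleftrightarrow> v \<phi> \<and> v \<psi>)"

lemma world_derivable: "world v \<Longrightarrow> \<turnstile> \<phi> \<Longrightarrow> v \<phi>"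
  and world_Neg: "world v \<Longrightarrow> v (Neg \<phi>) \<longleftrightarrow> \<not> v \<phi>"
  and world_And: "world v \<Longrightarrow> v (And \<phi> \<psi>) \<longleftrightarrow> v \<phi> \<and> v \<psi>"
  unfolding world_def by blast+

lemma world_Or: "world v \<Longrightarrow> v (Or \<phi> \<psi>) \<longleftrightarrow> v \<phi> \<or> v \<psi>"
  and world_Imp: "world v \<Longrightarrow> v (Imp \<phi> \<psi>) \<longleftrightarrow> (v \<phi> \<longrightarrow> v \<psi>)"
  and world_Bot: "world v \<Longrightarrow> \<not> v Bot"
  by (auto simp: Or_def Imp_def Bot_def Let_def world_Neg[of v] world_And[of v])

text \<open>As rewrite rules these must be instantiated with a valuation: their left-hand sides have a
  variable as head and match any formula.\<close>

lemmas world_simps = world_Neg world_And world_Or world_Imp world_Bot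

section \<open>Propositional derivations\<close>

abbreviation PImp :: "pform \<Rightarrow> pform \<Rightarrow> pform" where
  "PImp A B \<equiv> PNeg (PAnd A (PNeg B))"

definition sub3 :: "'p fm \<Rightarrow> 'p fm \<Rightarrow> 'p fm \<Rightarrow> nat \<Rightarrow> 'p fm" where
  "sub3 a b c n = (if n = 0 then a else if n = 1 then b else c)"

text \<open>Propositional variables 0, 1, 2 stand for \<open>a\<close>, \<open>b\<close>,
  \<open>c\<close>, so each scheme below becomes a truth-table check. Such derivations serve to
  build worlds; afterwards \<open>derivable_if_valid\<close> replaces them by evaluation.\<close>

lemma taut3:
  assumes "\<And>v. peval v A"
  shows "\<turnstile> subst (sub3 a b c) A"
  using assms by (intro Taut) (simp add: tautology_def)

lemma Imp_refl: "\<turnstile> Imp a a"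
  using taut3[of "PImp (PVar 0) (PVar 0)" a] by (simp add: sub3_def Imp_def)

lemma Imp_weaken: "\<turnstile> b \<Longrightarrow> \<turnstile> Imp a b"
  using taut3[of "PImp (PVar 1) (PImp (PVar 0) (PVar 1))" a b]
  by (auto simp: sub3_def Imp_def intro: MP)

lemma Imp_trans:
  assumes "\<turnstile> Imp a b" "\<turnstile> Imp b c"
  shows "\<turnstile> Imp a c"
proof -
  have "\<turnstile> Imp (Imp a b) (Imp (Imp b c) (Imp a c))"
    using taut3[of "PImp (PImp (PVar 0) (PVar 1))
      (PImp (PImp (PVar 1) (PVar 2)) (PImp (PVar 0) (PVar 2)))" a b c]
    by (simp add: sub3_def Imp_def)
  then show ?thesis using assms MP by blast
qed

lemma And_left: "\<turnstile> Imp (And a b) a"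
  using taut3[of "PImp (PAnd (PVar 0) (PVar 1)) (PVar 0)" a b] by (simp add: sub3_def Imp_def)

lemma And_right: "\<turnstile> Imp (And a b) b"
  using taut3[of "PImp (PAnd (PVar 0) (PVar 1)) (PVar 1)" a b] by (simp add: sub3_def Imp_def)

lemma Imp_And:
  assumes "\<turnstile> Imp a b" "\<turnstile> Imp a c"
  shows "\<turnstile> Imp a (And b c)"
proof -
  have "\<turnstile> Imp (Imp a b) (Imp (Imp a c) (Imp a (And b c)))"
    using taut3[of "PImp (PImp (PVar 0) (PVar 1))
      (PImp (PImp (PVar 0) (PVar 2)) (PImp (PVar 0) (PAnd (PVar 1) (PVar 2))))" a b c]
    by (simp add: sub3_def Imp_def)
  then show ?thesis using assms MP by blast
qed

lemma Imp_contradiction: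
  assumes "\<turnstile> Imp a b" "\<turnstile> Imp a (Neg b)"
  shows "\<turnstile> Neg a"
proof -
  have "\<turnstile> subst (sub3 a b b) (PImp (PImp (PVar 0) (PVar 1))
      (PImp (PImp (PVar 0) (PNeg (PVar 1))) (PNeg (PVar 0))))"
    by (rule taut3) auto
  then have "\<turnstile> Imp (Imp a b) (Imp (Imp a (Neg b)) (Neg a))"
    by (simp add: sub3_def Imp_def)
  then show ?thesis using assms MP by blast
qed

lemma Neg_And_imp:
  assumes "\<turnstile> Neg (And a b)"
  shows "\<turnstile> Imp a (Neg b)"
proof -
  have "\<turnstile> Imp (Neg (And a b)) (Imp a (Neg b))"
    using taut3[of "PImp (PNeg (PAnd (PVar 0) (PVar 1)))
      (PImp (PVar 0) (PNeg (PVar 1)))" a b]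
    by (simp add: sub3_def Imp_def)
  then show ?thesis using assms MP by blast
qed

lemma double_NegD:
  assumes "\<turnstile> Neg (Neg a)"
  shows "\<turnstile> a"
proof -
  have "\<turnstile> Imp (Neg (Neg a)) a"
    using taut3[of "PImp (PNeg (PNeg (PVar 0))) (PVar 0)" a] by (simp add: sub3_def Imp_def)
  then show ?thesis using assms MP by blast
qed

text \<open>Lindenbaum's construction, with each stage kept as one conjunction: being a consequence
  of a stage is then derivability of a single implication. The negation of a rejected formula
  already follows from the stage.\<close>

primrec linden :: "'p::countable fm \<Rightarrow> nat \<Rightarrow> 'p fm" where
  "linden \<phi> 0 = \<phi>"
| "linden \<phi> (Suc n) = (if consistent (And (linden \<phi> n) (from_nat n))
     then And (linden \<phi> n) (from_nat n) else linden \<phi> n)"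

lemma consistent_linden: "consistent \<phi> \<Longrightarrow> consistent (linden \<phi> n)"
  by (induction n) auto

lemma linden_mono: "m \<le> n \<Longrightarrow> \<turnstile> Imp (linden \<phi> n) (linden \<phi> m)"
  by (induction n rule: dec_induct) (auto intro: Imp_refl And_left Imp_trans)

text \<open>Step \<open>to_nat \<psi>\<close> examines \<open>\<psi>\<close> itself. Either
  \<open>\<psi>\<close> becomes a conjunct, or it is inconsistent with the stage, which therefore
  implies \<open>Neg \<psi>\<close>.\<close>

lemma linden_decides:
  "\<exists>n. (\<turnstile> Imp (linden \<phi> n) \<psi>) \<or> (\<turnstile> Imp (linden \<phi> n) (Neg \<psi>))"
proof (rule exI[of _ "Suc (to_nat \<psi>)"])
  show "(\<turnstile> Imp (linden \<phi> (Suc (to_nat \<psi>))) \<psi>) \<or> (\<turnstile> Imp (linden \<phi> (Suc (to_nat \<psi>))) (Neg \<psi>))"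
    by (auto simp: consistent_def intro: And_right Neg_And_imp)
qed

lemma consistent_world:
  fixes \<phi> :: "'p::countable fm"
  assumes "consistent \<phi>"
  shows "\<exists>v. world v \<and> v \<phi>"
proof -
  define v where "v \<psi> \<longleftrightarrow> (\<exists>n. \<turnstile> Imp (linden \<phi> n) \<psi>)" for \<psi>
  have v_mono: "v \<psi>" if "v \<chi>" "\<turnstile> Imp \<chi> \<psi>" for \<chi> \<psi>
    using that unfolding v_def by (blast intro: Imp_trans)
  \<comment> \<open>The stages form a chain under derivable implication, so two consequences of the
    chain are consequences of the later of their two stages.\<close>
  have v_common: "\<exists>n. (\<turnstile> Imp (linden \<phi> n) \<chi>) \<and> (\<turnstile> Imp (linden \<phi> n) \<psi>)" if chi_psi: "v \<chi>" "v \<psi>" for \<chi> \<psi>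
  proof -
    obtain m n where "\<turnstile> Imp (linden \<phi> m) \<chi>" "\<turnstile> Imp (linden \<phi> n) \<psi>"
      using chi_psi unfolding v_def by blast
    then have "(\<turnstile> Imp (linden \<phi> (max m n)) \<chi>) \<and> (\<turnstile> Imp (linden \<phi> (max m n)) \<psi>)"
      by (meson Imp_trans linden_mono max.cobounded1 max.cobounded2)
    then show ?thesis ..
  qed
  have "v \<psi>" if "\<turnstile> \<psi>" for \<psi>
    using that unfolding v_def by (blast intro: Imp_weaken)
  moreover have "v (Neg \<psi>) \<longleftrightarrow> \<not> v \<psi>" for \<psi>
  proof
    show "\<not> v \<psi>" if "v (Neg \<psi>)"
      using v_common[OF _ that] consistent_linden[OF assms]
      by (auto simp: consistent_def dest: Imp_contradiction)
    show "v (Neg \<psi>)" if "\<not> v \<psi>"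
      using that linden_decides[of \<phi> \<psi>] unfolding v_def by blast
  qed
  moreover have "v (And \<chi> \<psi>) \<longleftrightarrow> v \<chi> \<and> v \<psi>" for \<chi> \<psi>
  proof
    show "v \<chi> \<and> v \<psi>" if "v (And \<chi> \<psi>)"
      using that v_mono And_left And_right by blast
    show "v (And \<chi> \<psi>)" if "v \<chi> \<and> v \<psi>"
      using that v_common[of \<chi> \<psi>] Imp_And unfolding v_def by blast
  qed
  moreover have "v \<phi>"
    unfolding v_def by (rule exI[of _ 0]) (simp add: Imp_refl)
  ultimately show ?thesis
    unfolding world_def by blast
qed

text \<open>Completeness with respect to worlds: otherwise \<open>Neg \<phi>\<close> would be
  consistent and hold in some world.\<close>

lemma derivable_if_valid:
  fixes \<phi> :: "'p::countable fm"
  assumes "\<And>v. world v \<Longrightarrow> v \<phi>"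
  shows "\<turnstile> \<phi>"
proof (rule ccontr)
  assume "\<not> (\<turnstile> \<phi>)"
  then have "consistent (Neg \<phi>)"
    by (auto simp: consistent_def dest: double_NegD)
  then show False
    using assms consistent_world world_Neg by blast
qed

section \<open>The modalities over disjunctions\<close>

text \<open>By \<open>entails_Imp\<close> this yields derivable implications, so the premises of R1,
  R1' and R2 can be established by evaluation in worlds.\<close>

definition entails :: "'p fm \<Rightarrow> 'p fm \<Rightarrow> bool" where
  "entails \<phi> \<psi> \<longleftrightarrow> (\<forall>v. world v \<longrightarrow> v \<phi> \<longrightarrow> v \<psi>)"

lemma entails_Imp:
  fixes \<phi> :: "'p::countable fm"
  shows "entails \<phi> \<psi> \<Longrightarrow> \<turnstile> Imp \<phi> \<psi>"
  by (rule derivable_if_valid) (metis entails_def world_Imp)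

lemma entails_Or1: "entails \<phi> (Or \<phi> \<psi>)"
  and entails_Or2: "entails \<psi> (Or \<phi> \<psi>)"
  and entails_Or_commute: "entails (Or \<phi> \<psi>) (Or \<psi> \<phi>)"
  unfolding entails_def using world_Or by blast+

lemma L0_mono:
  fixes \<phi> :: "'p::countable fm"
  assumes "world v" "entails \<phi> \<psi>" "v (L 0 \<phi>)"
  shows "v (L 0 \<psi>)"
  using world_derivable[OF assms(1) R2[OF entails_Imp[OF assms(2)]]] assms(3)
  by (simp add: world_simps[OF assms(1)])

lemma L0_Bot: "world v \<Longrightarrow> \<not> v (L 0 Bot)"
  using world_derivable[OF _ A1] world_Neg by blast

lemma L0_Or:
  fixes \<phi> :: "'p::countable fm"
  assumes v: "world v"
  shows "v (L 0 (Or \<phi> \<psi>)) \<longleftrightarrow> v (L 0 \<phi>) \<or> v (L 0 \<psi>)"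
proof
  show "v (L 0 \<phi>) \<or> v (L 0 \<psi>)" if "v (L 0 (Or \<phi> \<psi>))"
    using world_derivable[OF v A4] that by (auto simp: world_simps[OF v])
  show "v (L 0 (Or \<phi> \<psi>))" if "v (L 0 \<phi>) \<or> v (L 0 \<psi>)"
    using that L0_mono[OF v entails_Or1] L0_mono[OF v entails_Or2] by blast
qed

text \<open>The laws shared by \<open>L r\<close> and \<open>M r\<close>, so that the decomposition
  over disjunctions is proved once for both. The second clause passes from weaker to stronger
  formulae, as bounds on a set of weights carry over to non-empty subsets.\<close>

definition bound_modality :: "('p fm \<Rightarrow> bool) \<Rightarrow> ('p fm \<Rightarrow> 'p fm) \<Rightarrow> bool" where
  "bound_modality v K \<longleftrightarrow>
     (\<forall>\<phi>. v (K \<phi>) \<longrightarrow> v (L 0 \<phi>)) \<and>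
     (\<forall>\<phi> \<psi>. entails \<phi> \<psi> \<longrightarrow> v (K \<psi>) \<longrightarrow> v (L 0 \<phi>) \<longrightarrow> v (K \<phi>)) \<and>
     (\<forall>\<phi> \<psi>. v (K \<phi>) \<longrightarrow> v (K \<psi>) \<longrightarrow> v (K (Or \<phi> \<psi>))) \<and>
     (\<forall>\<phi> \<psi>. v (K \<phi>) \<longrightarrow> \<not> v (L 0 \<psi>) \<longrightarrow> v (K (Or \<phi> \<psi>)))"

lemma nnrat_0_le [simp]: "0 \<le> (r :: nnrat)"
  by transfer simp

text \<open>A2, A2' and A6 express a strict inequality by adding a positive number; this restores
  the order form.\<close>

lemma nnrat_less_iff_add: "(r :: nnrat) < s \<longleftrightarrow> (\<exists>q>0. s = r + q)"
proof (transfer, intro iffI)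
  fix r s :: rat assume "0 \<le> r" "0 \<le> s" "r < s"
  then show "\<exists>q\<in>{r. 0 \<le> r}. 0 < q \<and> s = r + q"
    by (intro bexI[of _ "s - r"]) auto
qed auto

lemma L_antimono:
  assumes v: "world v" and "v (L s \<phi>)" "r \<le> s"
  shows "v (L r \<phi>)"
proof (cases "r = s")
  case False
  then obtain q where "q > 0" "s = r + q"
    using assms(3) nnrat_less_iff_add by (metis order_le_neq_trans)
  then show ?thesis
    using world_derivable[OF v A2] assms(2) by (auto simp: world_simps[OF v])
qed (use assms in simp)

lemma M_mono:
  assumes v: "world v" and "v (M r \<phi>)" "r \<le> s"
  shows "v (M s \<phi>)"
proof (cases "r = s")
  case False
  then obtain q where "q > 0" "s = r + q"
    using assms(3) nnrat_less_iff_add by (metis order_le_neq_trans)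
  then show ?thesis
    using world_derivable[OF v A2'] assms(2) by (auto simp: world_simps[OF v])
qed (use assms in simp)

lemma L_le_M:
  assumes v: "world v" and "v (L s \<phi>)" "v (M r \<phi>)"
  shows "s \<le> r"
proof (rule ccontr)
  assume "\<not> s \<le> r"
  then obtain q where "q > 0" "s = r + q"
    using nnrat_less_iff_add by (metis not_le)
  then show False
    using world_derivable[OF v A6] assms(2,3) by (auto simp: world_simps[OF v])
qed

lemma bound_modality_L:
  fixes v :: "'p::countable fm \<Rightarrow> bool"
  assumes v: "world v"
  shows "bound_modality v (L r)"
  unfolding bound_modality_def
proof (intro conjI allI impI)
  fix \<phi> \<psi> :: "'p fm"
  show "v (L 0 \<phi>)" if "v (L r \<phi>)"
    using L_antimono[OF v that] by simp
  show "v (L r \<phi>)" if "entails \<phi> \<psi>" "v (L r \<psi>)" "v (L 0 \<phi>)"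
    using world_derivable[OF v R1[OF entails_Imp[OF that(1)], of r]] that
    by (simp add: world_simps[OF v])
  show "v (L r (Or \<phi> \<psi>))" if "v (L r \<phi>)" "v (L r \<psi>)"
    using world_derivable[OF v A3[of r \<phi> r \<psi>]] that by (simp add: world_simps[OF v])
  show "v (L r (Or \<phi> \<psi>))" if "v (L r \<phi>)" "\<not> v (L 0 \<psi>)"
    using world_derivable[OF v A5[of \<psi> r \<phi>]] that by (simp add: world_simps[OF v])
qed

lemma bound_modality_M:
  fixes v :: "'p::countable fm \<Rightarrow> bool"
  assumes v: "world v"
  shows "bound_modality v (M r)"
  unfolding bound_modality_def
proof (intro conjI allI impI)
  fix \<phi> \<psi> :: "'p fm"
  show "v (L 0 \<phi>)" if "v (M r \<phi>)"
    using world_derivable[OF v A7[of r \<phi>]] that by (simp add: world_simps[OF v])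
  show "v (M r \<phi>)" if "entails \<phi> \<psi>" "v (M r \<psi>)" "v (L 0 \<phi>)"
    using world_derivable[OF v R1'[OF entails_Imp[OF that(1)], of r]] that
    by (simp add: world_simps[OF v])
  show "v (M r (Or \<phi> \<psi>))" if "v (M r \<phi>)" "v (M r \<psi>)"
    using world_derivable[OF v A3'[of r \<phi> r \<psi>]] that by (simp add: world_simps[OF v])
  show "v (M r (Or \<phi> \<psi>))" if "v (M r \<phi>)" "\<not> v (L 0 \<psi>)"
    using world_derivable[OF v A5'[of \<psi> r \<phi>]] that by (simp add: world_simps[OF v])
qed

text \<open>\<open>K \<phi>\<close> gives \<open>L 0 \<phi>\<close>, hence \<open>L 0 \<psi>\<close>
  by R2, which is the side condition for transferring \<open>K\<close> along the other
  entailment.\<close>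

lemma bound_modality_cong:
  fixes v :: "'p::countable fm \<Rightarrow> bool"
  assumes "world v" "bound_modality v K" "entails \<phi> \<psi>" "entails \<psi> \<phi>"
  shows "v (K \<phi>) \<longleftrightarrow> v (K \<psi>)"
  using assms L0_mono unfolding bound_modality_def by metis

text \<open>Bounds on a union hold iff they hold on each non-empty part and some part is non-empty;
  \<open>L 0\<close> expresses non-emptiness.\<close>

lemma bound_modality_Or:
  fixes v :: "'p::countable fm \<Rightarrow> bool"
  assumes v: "world v" and K: "bound_modality v K"
  shows "v (K (Or \<phi> \<psi>)) \<longleftrightarrow> (v (L 0 \<phi>) \<or> v (L 0 \<psi>)) \<and>
    (v (L 0 \<phi>) \<longrightarrow> v (K \<phi>)) \<and> (v (L 0 \<psi>) \<longrightarrow> v (K \<psi>))" (is "?l \<longleftrightarrow> ?r")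
proof
  show ?r if ?l
    using that K L0_Or[OF v] entails_Or1 entails_Or2 unfolding bound_modality_def by blast
  \<comment> \<open>The last clause of \<open>bound_modality\<close> treats an impossible right
    disjunct only; commuting covers an impossible left one.\<close>
  have "v (K (Or \<phi> \<psi>)) \<longleftrightarrow> v (K (Or \<psi> \<phi>))"
    by (rule bound_modality_cong[OF v K entails_Or_commute entails_Or_commute])
  then show ?l if ?r
    using that K unfolding bound_modality_def by blast
qed

primrec Disj :: "'p fm list \<Rightarrow> 'p fm" where
  "Disj [] = Bot"
| "Disj (\<phi> # \<phi>s) = Or \<phi> (Disj \<phi>s)"

lemma world_Disj: "world v \<Longrightarrow> v (Disj \<phi>s) \<longleftrightarrow> (\<exists>\<phi>\<in>set \<phi>s. v \<phi>)"
  by (induction \<phi>s) (auto simp: world_simps[of v])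

lemma L0_Disj:
  fixes v :: "'p::countable fm \<Rightarrow> bool"
  shows "world v \<Longrightarrow> v (L 0 (Disj \<phi>s)) \<longleftrightarrow> (\<exists>\<phi>\<in>set \<phi>s. v (L 0 \<phi>))"
  by (induction \<phi>s) (auto simp: L0_Bot[of v] L0_Or[of v])

lemma bound_modality_Disj:
  fixes v :: "'p::countable fm \<Rightarrow> bool"
  assumes v: "world v" and K: "bound_modality v K"
  shows "v (K (Disj \<phi>s)) \<longleftrightarrow>
    (\<exists>\<phi>\<in>set \<phi>s. v (L 0 \<phi>)) \<and> (\<forall>\<phi>\<in>set \<phi>s. v (L 0 \<phi>) \<longrightarrow> v (K \<phi>))"
proof (induction \<phi>s)
  case Nil
  show ?case using K L0_Bot[OF v] by (auto simp: bound_modality_def)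
next
  case (Cons \<phi> \<phi>s)
  then show ?case
    by (auto simp: bound_modality_Or[OF v K] L0_Disj[OF v])
qed

section \<open>The finite model\<close>

primrec subfms :: "'p fm \<Rightarrow> 'p fm set" where
  "subfms (Atom p) = {Atom p}"
| "subfms (Neg \<phi>) = insert (Neg \<phi>) (subfms \<phi>)"
| "subfms (And \<phi> \<psi>) = insert (And \<phi> \<psi>) (subfms \<phi> \<union> subfms \<psi>)"
| "subfms (L r \<phi>) = insert (L r \<phi>) (subfms \<phi>)"
| "subfms (M r \<phi>) = insert (M r \<phi>) (subfms \<phi>)"

primrec bounds :: "'p fm \<Rightarrow> nnrat set" where
  "bounds (Atom p) = {}"
| "bounds (Neg \<phi>) = bounds \<phi>"
| "bounds (And \<phi> \<psi>) = bounds \<phi> \<union> bounds \<psi>"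
| "bounds (L r \<phi>) = insert r (bounds \<phi>)"
| "bounds (M r \<phi>) = insert r (bounds \<phi>)"

lemma finite_subfms: "finite (subfms \<phi>)"
  and finite_bounds: "finite (bounds \<phi>)"
  by (induction \<phi>) auto

lemma self_subfms: "\<phi> \<in> subfms \<phi>"
  by (cases \<phi>) auto

text \<open>The conjunction, over \<open>C\<close>, of each formula or its negation as
  \<open>A\<close> prescribes.\<close>

lemma characteristic_formula:
  fixes A :: "'p fm \<Rightarrow> bool"
  assumes "finite C"
  shows "\<exists>\<chi>. \<forall>v. world v \<longrightarrow> (v \<chi> \<longleftrightarrow> (\<forall>\<psi>\<in>C. v \<psi> \<longleftrightarrow> A \<psi>))"
  using assms
proof induction
  case empty
  show ?case by (rule exI[of _ "Neg Bot"]) (use world_Neg world_Bot in blast)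
next
  case (insert \<psi> C)
  then obtain \<chi> where \<chi>: "\<forall>v. world v \<longrightarrow> (v \<chi> \<longleftrightarrow> (\<forall>\<psi>\<in>C. v \<psi> \<longleftrightarrow> A \<psi>))"
    by blast
  show ?case
  proof (rule exI[of _ "And (if A \<psi> then \<psi> else Neg \<psi>) \<chi>"], intro allI impI)
    fix v :: "'p fm \<Rightarrow> bool" assume v: "world v"
    show "v (And (if A \<psi> then \<psi> else Neg \<psi>) \<chi>) \<longleftrightarrow> (\<forall>\<psi>\<in>insert \<psi> C. v \<psi> \<longleftrightarrow> A \<psi>)"
      using \<chi> v by (auto simp: world_simps[OF v])
  qed
qed

text \<open>Worlds matter only through their traces on \<open>C\<close>, of which there are at most
  as many as subsets of \<open>C\<close>. A list is chosen so that its indices can serve as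
  states.\<close>

lemma finitely_many_worlds:
  fixes C :: "'p fm set"
  assumes "finite C"
  obtains ws where "\<forall>w\<in>set ws. world w"
    and "\<forall>v. world v \<longrightarrow> (\<exists>w\<in>set ws. \<forall>\<psi>\<in>C. v \<psi> \<longleftrightarrow> w \<psi>)"
proof -
  let ?tr = "\<lambda>v. {\<psi>\<in>C. v \<psi>}"
  have "finite (?tr ` Collect world)"
    by (rule finite_subset[of _ "Pow C"]) (use assms in auto)
  then obtain V where V: "V \<subseteq> Collect world" "finite V" "?tr ` Collect world = ?tr ` V"
    by (meson finite_subset_image order_refl)
  obtain ws where ws: "set ws = V"
    using finite_list[OF V(2)] by blast
  have "\<exists>w\<in>set ws. \<forall>\<psi>\<in>C. v \<psi> \<longleftrightarrow> w \<psi>" if "world v" for v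
  proof -
    have "?tr v \<in> ?tr ` V"
      using that V(3) by blast
    then show ?thesis unfolding ws by blast
  qed
  moreover have "world w" if "w \<in> set ws" for w
    using that V(1) ws by blast
  ultimately show ?thesis
    by (intro that[of ws] ballI allI impI)
qed

section \<open>Weights of transitions\<close>

abbreviation nnreal :: "nnrat \<Rightarrow> real" where
  "nnreal r \<equiv> of_rat (rat_of_nnrat r)"

lemma nnreal_le_iff: "nnreal r \<le> nnreal s \<longleftrightarrow> r \<le> s"
  by (simp add: of_rat_less_eq less_eq_nnrat.rep_eq)

lemma rat_of_nnrat_nonneg [simp]: "0 \<le> rat_of_nnrat r"
  using rat_of_nnrat[of r] by simp

text \<open>If \<open>L 0 \<chi>\<close> holds, the interval from the largest asserted lower bound
  in \<open>R\<close> (or 0) to the smallest asserted upper bound in \<open>R\<close>, unbounded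
  above if there is none.\<close>

definition weights :: "nnrat set \<Rightarrow> ('p fm \<Rightarrow> bool) \<Rightarrow> 'p fm \<Rightarrow> real set" where
  "weights R v \<chi> = {x. 0 \<le> x \<and> v (L 0 \<chi>) \<and>
     (\<forall>r\<in>R. (v (L r \<chi>) \<longrightarrow> nnreal r \<le> x) \<and> (v (M r \<chi>) \<longrightarrow> x \<le> nnreal r))}"

text \<open>The largest asserted lower bound exists because \<open>0 \<in> R\<close>, and is itself
  a weight since \<open>L_le_M\<close> keeps it below every asserted upper bound.\<close>

lemma weights_lower:
  assumes v: "world v" and R: "finite R" "0 \<in> R" and 0: "v (L 0 \<chi>)"
  obtains s where "s \<in> R" "v (L s \<chi>)" "nnreal s \<in> weights R v \<chi>"
proof -
  let ?S = "{r\<in>R. v (L r \<chi>)}"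
  have S: "finite ?S" "?S \<noteq> {}"
    using R 0 by auto
  have le: "r \<le> Max ?S" if "r \<in> ?S" for r
    using S that by simp
  have M: "Max ?S \<in> ?S"
    using Max_in[OF S] .
  have "nnreal (Max ?S) \<in> weights R v \<chi>"
    using M 0 le by (auto simp: weights_def nnreal_le_iff intro: L_le_M[OF v])
  with M show ?thesis using that by blast
qed

text \<open>The smallest asserted upper bound is a weight, and by \<open>M_mono\<close> it exceeds
  every unasserted \<open>r\<close>.\<close>

lemma weights_upper:
  assumes v: "world v" and R: "finite R" and 0: "v (L 0 \<chi>)" and r: "r \<in> R" "\<not> v (M r \<chi>)"
  shows "\<exists>x\<in>weights R v \<chi>. nnreal r < x"
proof (cases "\<exists>s\<in>R. v (M s \<chi>)")
  case True
  let ?S = "{s\<in>R. v (M s \<chi>)}"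
  have S: "finite ?S" "?S \<noteq> {}"
    using R True by auto
  have m: "Min ?S \<in> ?S"
    using Min_in[OF S] .
  have le: "Min ?S \<le> s" if "s \<in> ?S" for s
    using S that by simp
  have "nnreal (Min ?S) \<in> weights R v \<chi>"
    using m 0 le by (auto simp: weights_def nnreal_le_iff intro: L_le_M[OF v])
  moreover have "\<not> Min ?S \<le> r"
    using m r M_mono[OF v] by blast
  ultimately show ?thesis
    using nnreal_le_iff not_le by blast
next
  case False
  have le: "nnreal s \<le> nnreal (Max R)" if "s \<in> R" for s
    using R that by (simp add: nnreal_le_iff)
  \<comment> \<open>Without an asserted upper bound, any number above all of \<open>R\<close> is a
    weight.\<close>
  have "nnreal (Max R) + 1 \<in> weights R v \<chi>"
    using False 0 le by (force simp: weights_def)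
  then show ?thesis
    using le[OF r(1)] by (intro bexI) auto
qed

lemma weights_L0: "x \<in> weights R v \<chi> \<Longrightarrow> v (L 0 \<chi>)"
  by (simp add: weights_def)

lemma weights_eq_empty:
  assumes "world v" "finite R" "0 \<in> R"
  shows "weights R v \<chi> = {} \<longleftrightarrow> \<not> v (L 0 \<chi>)"
proof (cases "v (L 0 \<chi>)")
  case True
  then show ?thesis using weights_lower[OF assms] by blast
qed (simp add: weights_def)

text \<open>Some weight is itself an asserted lower bound, so whatever lies below all weights is
  asserted by antitonicity.\<close>

lemma weights_L:
  assumes v: "world v" and R: "finite R" "0 \<in> R" and "v (L 0 \<chi>)" "r \<in> R"
  shows "v (L r \<chi>) \<longleftrightarrow> (\<forall>x\<in>weights R v \<chi>. nnreal r \<le> x)"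
proof
  show "\<forall>x\<in>weights R v \<chi>. nnreal r \<le> x" if "v (L r \<chi>)"
    using that assms(5) by (auto simp: weights_def)
  show "v (L r \<chi>)" if all: "\<forall>x\<in>weights R v \<chi>. nnreal r \<le> x"
    using weights_lower[OF assms(1-4)] all L_antimono[OF v] nnreal_le_iff by metis
qed

lemma weights_M:
  assumes v: "world v" and R: "finite R" and "v (L 0 \<chi>)" "r \<in> R"
  shows "v (M r \<chi>) \<longleftrightarrow> (\<forall>x\<in>weights R v \<chi>. x \<le> nnreal r)"
  using weights_upper[OF assms] assms(4) by (fastforce simp: weights_def)

section \<open>Truth in the model\<close>

lemma theta_minus_ge_iff:
  "ereal_of_nnrat r \<le> theta_minus W s T \<longleftrightarrow>
    theta W s T \<noteq> {} \<and> (\<forall>x\<in>theta W s T. nnreal r \<le> x)"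
  by (auto simp: theta_minus_def ereal_of_nnrat_def le_Inf_iff)

text \<open>The default \<infinity> on the empty set falsifies an upper bound just as -\<infinity>
  falsifies a lower one; hence the same non-emptiness conjunct in both equivalences.\<close>

lemma theta_plus_le_iff:
  "theta_plus W s T \<le> ereal_of_nnrat r \<longleftrightarrow>
    theta W s T \<noteq> {} \<and> (\<forall>x\<in>theta W s T. x \<le> nnreal r)"
  by (auto simp: theta_plus_def ereal_of_nnrat_def Sup_le_iff)

definition world_model ::
    "nnrat set \<Rightarrow> ('p fm \<Rightarrow> bool) list \<Rightarrow> (nat \<Rightarrow> 'p fm) \<Rightarrow> (nat, 'p) wts" where
  "world_model R ws \<chi> =
    \<lparr>states = {..<length ws},
     edges = {(i, x, j). i < length ws \<and> j < length ws \<and> x \<in> weights R (ws ! i) (\<chi> j)},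
     label = \<lambda>i. {p. (ws ! i) (Atom p)}\<rparr>"

lemma theta_world_model:
  "i < length ws \<Longrightarrow> T \<subseteq> {..<length ws} \<Longrightarrow>
    theta (world_model R ws \<chi>) i T = (\<Union>j\<in>T. weights R (ws ! i) (\<chi> j))"
  by (auto simp: theta_def world_model_def)

text \<open>\<open>C\<close> and \<open>R\<close> stay fixed while \<open>\<psi>\<close> descends to
  its subformulae, so the whole induction concerns one model.\<close>

lemma truth_lemma:
  fixes ws :: "('p::countable fm \<Rightarrow> bool) list"
  assumes R: "finite R" "0 \<in> R"
    and ws: "\<And>i. i < length ws \<Longrightarrow> world (ws ! i)"
    and complete: "\<And>v. world v \<Longrightarrow> \<exists>i<length ws. \<forall>\<psi>\<in>C. v \<psi> \<longleftrightarrow> (ws ! i) \<psi>"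
    and \<chi>: "\<And>i v. i < length ws \<Longrightarrow> world v \<Longrightarrow> v (\<chi> i) \<longleftrightarrow> (\<forall>\<psi>\<in>C. v \<psi> \<longleftrightarrow> (ws ! i) \<psi>)"
    and "subfms \<psi> \<subseteq> C" "bounds \<psi> \<subseteq> R" "i < length ws"
  shows "sat (world_model R ws \<chi>) i \<psi> \<longleftrightarrow> (ws ! i) \<psi>"
proof -
  let ?W = "world_model R ws \<chi>"
  have decompose: "(ws ! i) (K \<psi>) \<longleftrightarrow>
      (\<exists>j<length ws. (ws ! j) \<psi> \<and> (ws ! i) (L 0 (\<chi> j))) \<and>
      (\<forall>j<length ws. (ws ! j) \<psi> \<longrightarrow> (ws ! i) (L 0 (\<chi> j)) \<longrightarrow> (ws ! i) (K (\<chi> j)))"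
    if i: "i < length ws" and \<psi>: "\<psi> \<in> C" and K: "bound_modality (ws ! i) K" for i \<psi> K
  proof -
    \<comment> \<open>Every world satisfies the characteristic formula of some listed world, and
      that formula forces agreement on \<open>\<psi> \<in> C\<close>. So \<open>\<psi>\<close> is
      equivalent to \<open>D\<close>, and \<open>K\<close> distributes over
      \<open>D\<close>.\<close>
    define D where "D = Disj (map \<chi> (filter (\<lambda>j. (ws ! j) \<psi>) [0..<length ws]))"
    have "v \<psi> \<longleftrightarrow> v D" if v: "world v" for v
    proof -
      have "v D \<longleftrightarrow> (\<exists>j<length ws. (ws ! j) \<psi> \<and> v (\<chi> j))"
        by (auto simp: D_def world_Disj[OF v])
      then show ?thesis
        using complete[OF v] \<psi> \<chi>[OF _ v] by blast
    qed
    then have "(ws ! i) (K \<psi>) \<longleftrightarrow> (ws ! i) (K D)"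
      by (intro bound_modality_cong[OF ws[OF i] K]) (auto simp: entails_def)
    then show ?thesis
      by (auto simp: D_def bound_modality_Disj[OF ws[OF i] K])
  qed
  show ?thesis
    using assms(6-8)
  proof (induction \<psi> arbitrary: i)
    case (Atom p)
    show ?case by (simp add: world_model_def)
  next
    case (L r \<psi>)
    let ?T = "{j. j < length ws \<and> (ws ! j) \<psi>}"
    have T: "{t \<in> states ?W. sat ?W t \<psi>} = ?T"
      using L by (auto simp: world_model_def)
    have "theta ?W i ?T = (\<Union>j\<in>?T. weights R (ws ! i) (\<chi> j))"
      using L.prems by (intro theta_world_model) auto
    moreover have "\<psi> \<in> C" "r \<in> R"
      using L.prems self_subfms by auto
    \<comment> \<open>Non-emptiness of the union matches the existential conjunct of
      \<open>decompose\<close>, and the bound on all its weights matches the universal one.\<close>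
    ultimately show ?case
      unfolding sat.simps T theta_minus_ge_iff
      using decompose[OF L.prems(3) _ bound_modality_L[OF ws[OF L.prems(3)]], of \<psi> r]
        weights_eq_empty[OF ws[OF L.prems(3)] R] weights_L[OF ws[OF L.prems(3)] R]
      by (auto dest: weights_L0)
  next
    case (M r \<psi>)
    let ?T = "{j. j < length ws \<and> (ws ! j) \<psi>}"
    have T: "{t \<in> states ?W. sat ?W t \<psi>} = ?T"
      using M by (auto simp: world_model_def)
    have "theta ?W i ?T = (\<Union>j\<in>?T. weights R (ws ! i) (\<chi> j))"
      using M.prems by (intro theta_world_model) auto
    moreover have "\<psi> \<in> C" "r \<in> R"
      using M.prems self_subfms by auto
    ultimately show ?case
      unfolding sat.simps T theta_plus_le_iff
      using decompose[OF M.prems(3) _ bound_modality_M[OF ws[OF M.prems(3)]], of \<psi> r]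
        weights_eq_empty[OF ws[OF M.prems(3)] R] weights_M[OF ws[OF M.prems(3)] R(1)]
      by (auto dest: weights_L0)
  next
    case (Neg \<psi>)
    then show ?case by (simp add: world_simps[OF ws[OF Neg.prems(3)]])
  next
    case (And \<psi> \<psi>')
    then show ?case by (simp add: world_simps[OF ws[OF And.prems(3)]])
  qed
qed

theorem theorem4p9:
  fixes \<phi> :: "'p :: countable fm"
  assumes "consistent \<phi>"
  shows "\<exists>(W :: (nat, 'p) wts) s. is_wts W \<and> finite (states W) \<and> s \<in> states W \<and> sat W s \<phi>"
proof -
  \<comment> \<open>Inserting 0 guarantees that every possible transition has an asserted lower
    bound in \<open>?R\<close>.\<close>
  let ?C = "subfms \<phi>" and ?R = "insert 0 (bounds \<phi>)"
  obtain v where v: "world v" "v \<phi>"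
    using consistent_world[OF assms] by blast
  obtain ws where ws: "\<forall>w\<in>set ws. world w"
    and complete: "\<forall>u. world u \<longrightarrow> (\<exists>w\<in>set ws. \<forall>\<psi>\<in>?C. u \<psi> \<longleftrightarrow> w \<psi>)"
    by (rule finitely_many_worlds[OF finite_subfms[of \<phi>]]) (rule that)
  have complete': "\<exists>i<length ws. \<forall>\<psi>\<in>?C. u \<psi> \<longleftrightarrow> (ws ! i) \<psi>" if u: "world u" for u
  proof -
    obtain w where w: "w \<in> set ws" "\<forall>\<psi>\<in>?C. u \<psi> \<longleftrightarrow> w \<psi>"
      using complete[rule_format, OF u] by (rule bexE)
    obtain j where "j < length ws" "ws ! j = w"
      using w(1) by (auto simp: in_set_conv_nth)
    with w(2) show ?thesis by auto
  qed
  have "\<forall>i. \<exists>\<chi>. \<forall>v. world v \<longrightarrow> (v \<chi> \<longleftrightarrow> (\<forall>\<psi>\<in>?C. v \<psi> \<longleftrightarrow> (ws ! i) \<psi>))"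
    by (intro allI characteristic_formula finite_subfms)
  from choice[OF this] obtain \<chi>
    where \<chi>: "\<forall>i v. world v \<longrightarrow> (v (\<chi> i) \<longleftrightarrow> (\<forall>\<psi>\<in>?C. v \<psi> \<longleftrightarrow> (ws ! i) \<psi>))" ..
  \<comment> \<open>The listed world that agrees with \<open>v\<close> on \<open>?C\<close>
    satisfies \<open>\<phi>\<close>, as \<open>\<phi>\<close> is its own subformula.\<close>
  obtain i where i: "i < length ws" "(ws ! i) \<phi>"
    using complete'[OF v(1)] v(2) self_subfms[of \<phi>] by auto
  let ?W = "world_model ?R ws \<chi>"
  have "sat ?W i \<phi> \<longleftrightarrow> (ws ! i) \<phi>"
  proof (rule truth_lemma[where C = ?C])
    show "world (ws ! j)" if "j < length ws" for j
      using that by (intro ws[rule_format] nth_mem)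
    show "u (\<chi> j) \<longleftrightarrow> (\<forall>\<psi>\<in>?C. u \<psi> \<longleftrightarrow> (ws ! j) \<psi>)" if "world u" for u j
      using \<chi>[rule_format, OF that] .
  qed (use complete' i(1) in \<open>simp_all add: finite_bounds subset_insertI\<close>)
  moreover have "is_wts ?W" "finite (states ?W)" "i \<in> states ?W"
    using i by (auto simp: is_wts_def world_model_def weights_def)
  ultimately show ?thesis using i(2) by (intro exI[of _ ?W] exI[of _ i]) simp
qed

end
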